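(* Let $f:X\to\mathcal P(Z)$ be a set-valued function. The following statements are equivalent: (i) $f$ is the pointwise supremum of its e-affine minorants, i.e. $f(x)+K=\bigcap_{a\in\mathcal E_f}(a(x)+K)$ for all $x\in X$; (ii) $f$ is $K$-e-convex and either $f_K$ is proper, or $f_K\equiv\emptyset$, or $f_K\equiv Z$.
   Context: $X$ and $Z$ are nontrivial real separated (Hausdorff) locally convex spaces with topological duals $X^*,Z^*$ and duality pairings $\langle\cdot,\cdot\rangle$. $K\subset Z$ is a fixed convex cone with $\{0\}\subsetneq K\subsetneq Z$, and $K^*=\{z^*\in Z^*:\langle z,z^*\rangle\le 0\ \forall z\in K\}$. $\mathcal P(Z)$ is the set of all subsets of $Z$ (including $\emptyset$); $A+B$ is the Minkowski sum, with $A+\emptyset=\emptyset$. For $A,B\subseteq Z$, $A\le_K B$ means $B\subseteq A+K$. A subset $C$ of a locally convex space $Y$ is e-convex if it is the intersection of a (possibly empty) family of open half-spaces; equivalently, for every $y_0\notin C$ there is $y^*\in Y^*$ with $\langle y-y_0,y^*\rangle<0$ for all $y\in C$. $\operatorname{e-conv}C$ is the smallest e-convex set containing $C$. $\mathcal R_K(Z)=\{A\subseteq Z: A=\operatorname{e-conv}(A+K)\}$. For $f:X\to\mathcal P(Z)$: $f_K(x)=f(x)+K$; $\operatorname{dom}f=\{x: f(x)\ne\emptyset\}$; $f$ is proper if $\operatorname{dom}f\neq\emptyset$ and $f(x)\ne Z$ for all $x\in\operatorname{dom}f$; $\operatorname{epi}_Kf=\{(x,z)\in X\times Z: z\in f(x)+K\}$;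 $f$ is $K$-e-convex if $\operatorname{epi}_Kf$ is an e-convex set in $X\times Z$. For $x^*\in X^*$, $z^*\in K^*\setminus\{0\}$: $S_{(x^*,z^* )}(x)=\{z\in Z:\langle x,x^*\rangle+\langle z,z^*\rangle<0\}$. A function $a:X\to\mathcal R_K(Z)$ is e-affine if there are $x^*,y^*\in X^*$, $z^*\in K^*\setminus\{0\}$, $\tilde z\in Z$ and $\alpha\in\mathbb R$ with $a(x)=S_{(x^*,z^* )}(x)+\tilde z$ if $\langle x,y^*\rangle<\alpha$ and $a(x)=\emptyset$ otherwise. $\mathcal E_f$ is the set of all e-affine functions $a$ with $a(x)\le_K f(x)$ for all $x\in X$ (the e-affine minorants of $f$). The intersection (supremum) over an empty family is $Z$.
   Formalization: Added hypothesis: K* ≠ {0} or f is not identically ∅. Otherwise, e.g. K the kernel of a discontinuous linear functional and f ≡ ∅, there are no e-affine functions, so (ii) holds but (i) reads ∅ = Z. *)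

theory Defs
  imports "HOL-Analysis.Analysis"
begin

section \<open>Separated real locally convex spaces\<close>

class locally_convex_space = real_vector + t2_space + topological_ab_group_add +
  assumes tendsto_scaleR_Pair:
    "LIM p (nhds (c::real) \<times>\<^sub>F nhds a). fst p *\<^sub>R snd p :> nhds (c *\<^sub>R a)"
  assumes locally_convex_at_0:
    "open U \<Longrightarrow> 0 \<in> U \<Longrightarrow> \<exists>V. open V \<and>
       (\<forall>x\<in>V. \<forall>y\<in>V. \<forall>u\<ge>0. \<forall>v\<ge>0. u + v = 1 \<longrightarrow> u *\<^sub>R x + v *\<^sub>R y \<in> V) \<and>
       0 \<in> V \<and> V \<subseteq> U"

text \<open>The class axiom spells out \<^const>\<open>convex\<close>, which is defined outside the class context.\<close>

lemma locally_convex: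
  fixes U :: "'a::locally_convex_space set"
  assumes "open U" "0 \<in> U"
  shows "\<exists>V. open V \<and> convex V \<and> 0 \<in> V \<and> V \<subseteq> U"
  using locally_convex_at_0[OF assms] unfolding convex_def .

lemma tendsto_scaleR_lcs:
  fixes a :: "'a::locally_convex_space"
  shows "(f \<longlongrightarrow> c) F \<Longrightarrow> (g \<longlongrightarrow> a) F \<Longrightarrow> ((\<lambda>x. f x *\<^sub>R g x) \<longlongrightarrow> c *\<^sub>R a) F"
  using filterlim_compose[OF tendsto_scaleR_Pair, of "\<lambda>x. (f x, g x)" c a F]
  by (simp add: nhds_prod[symmetric] tendsto_Pair)

instance real_normed_vector < locally_convex_space
proof
  fix c :: real and a :: 'a
  show "LIM p (nhds c \<times>\<^sub>F nhds a). fst p *\<^sub>R snd p :> nhds (c *\<^sub>R a)"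
    by (rule tendsto_scaleR[OF filterlim_fst filterlim_snd])
next
  fix U :: "'a set"
  assume "open U" "0 \<in> U"
  then obtain e where "e > 0" "ball 0 e \<subseteq> U"
    by (meson openE)
  then have "\<exists>V. open V \<and> convex V \<and> 0 \<in> V \<and> V \<subseteq> U"
    by (intro exI[of _ "ball 0 e"]) auto
  then show "\<exists>V. open V \<and>
       (\<forall>x\<in>V. \<forall>y\<in>V. \<forall>u\<ge>0. \<forall>v\<ge>0. u + v = 1 \<longrightarrow> u *\<^sub>R x + v *\<^sub>R y \<in> V) \<and>
       0 \<in> V \<and> V \<subseteq> U"
    unfolding convex_def .
qed

text \<open>The product topology makes \<open>X \<times> Z\<close> a locally convex space.\<close>

instance prod :: (topological_monoid_add, topological_monoid_add) topological_monoid_add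
proof
  fix a b :: "'a \<times> 'b"
  let ?F = "nhds a \<times>\<^sub>F nhds b"
  have 1: "filterlim fst (nhds a) ?F" and 2: "filterlim snd (nhds b) ?F"
    by (rule filterlim_fst filterlim_snd)+
  have "((\<lambda>p. (fst (fst p) + fst (snd p), snd (fst p) + snd (snd p)))
          \<longlongrightarrow> (fst a + fst b, snd a + snd b)) ?F"
    by (rule tendsto_Pair[OF tendsto_add[OF tendsto_fst[OF 1] tendsto_fst[OF 2]]
          tendsto_add[OF tendsto_snd[OF 1] tendsto_snd[OF 2]]])
  then show "LIM p ?F. fst p + snd p :> nhds (a + b)"
    by (simp add: plus_prod_def)
qed

instance prod :: (topological_comm_monoid_add, topological_comm_monoid_add)
  topological_comm_monoid_add ..

instance prod :: (topological_group_add, topological_group_add) topological_group_add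
proof
  fix a :: "'a \<times> 'b"
  have "((\<lambda>p. (- fst p, - snd p)) \<longlongrightarrow> (- fst a, - snd a)) (nhds a)"
    by (rule tendsto_Pair[OF tendsto_minus[OF tendsto_fst[OF filterlim_ident]]
          tendsto_minus[OF tendsto_snd[OF filterlim_ident]]])
  moreover have "(\<lambda>p :: 'a \<times> 'b. (- fst p, - snd p)) = uminus"
    by (simp add: fun_eq_iff uminus_prod_def)
  ultimately show "(uminus \<longlongrightarrow> - a) (nhds a)"
    by (simp add: uminus_prod_def[of a])
qed

instance prod :: (topological_ab_group_add, topological_ab_group_add)
  topological_ab_group_add ..

instance prod :: (locally_convex_space, locally_convex_space) locally_convex_space
proof
  fix c :: real and a :: "'a \<times> 'b"
  let ?F = "nhds c \<times>\<^sub>F nhds a"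
  have 1: "filterlim fst (nhds c) ?F" and 2: "filterlim snd (nhds a) ?F"
    by (rule filterlim_fst filterlim_snd)+
  have "((\<lambda>p. fst p *\<^sub>R fst (snd p)) \<longlongrightarrow> c *\<^sub>R fst a) ?F"
    by (rule tendsto_scaleR_lcs[OF 1 tendsto_fst[OF 2]])
  moreover have "((\<lambda>p. fst p *\<^sub>R snd (snd p)) \<longlongrightarrow> c *\<^sub>R snd a) ?F"
    by (rule tendsto_scaleR_lcs[OF 1 tendsto_snd[OF 2]])
  ultimately show "LIM p ?F. fst p *\<^sub>R snd p :> nhds (c *\<^sub>R a)"
    unfolding scaleR_prod_def by (rule tendsto_Pair)
next
  fix U :: "('a \<times> 'b) set"
  assume "open U" "0 \<in> U"
  then obtain A B where AB: "open A" "open B" "0 \<in> A" "0 \<in> B" "A \<times> B \<subseteq> U"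
    by (auto elim!: open_prod_elim simp: zero_prod_def)
  obtain V where V: "open V" "convex V" "0 \<in> V" "V \<subseteq> A"
    using locally_convex[OF AB(1,3)] by blast
  obtain W where W: "open W" "convex W" "0 \<in> W" "W \<subseteq> B"
    using locally_convex[OF AB(2,4)] by blast
  have "\<exists>V. open V \<and> convex V \<and> 0 \<in> V \<and> V \<subseteq> U"
    using V W AB(5) by (intro exI[of _ "V \<times> W"])
      (auto simp: open_Times convex_Times zero_prod_def)
  then show "\<exists>V. open V \<and>
       (\<forall>x\<in>V. \<forall>y\<in>V. \<forall>u\<ge>0. \<forall>v\<ge>0. u + v = 1 \<longrightarrow> u *\<^sub>R x + v *\<^sub>R y \<in> V) \<and>
       0 \<in> V \<and> V \<subseteq> U"
    unfolding convex_def .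
qed


section \<open>Duals and evenly convex sets\<close>

definition top_dual :: "('a::locally_convex_space \<Rightarrow> real) set" where
  "top_dual = {\<phi>. linear \<phi> \<and> continuous_on UNIV \<phi>}"

text \<open>The sign convention is that of the nonpositive polar cone.\<close>

definition polar_cone :: "'a::locally_convex_space set \<Rightarrow> ('a \<Rightarrow> real) set" where
  "polar_cone K = {\<phi> \<in> top_dual. \<forall>z\<in>K. \<phi> z \<le> 0}"

definition open_halfspace :: "'a::locally_convex_space set \<Rightarrow> bool" where
  "open_halfspace H \<longleftrightarrow>
     (\<exists>\<phi>\<in>top_dual. \<phi> \<noteq> (\<lambda>_. 0) \<and> (\<exists>\<alpha>. H = {y. \<phi> y < \<alpha>}))"

text \<open>The family \<open>\<H>\<close> may be empty, so the whole space is e-convex.\<close>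

definition e_convex :: "'a::locally_convex_space set \<Rightarrow> bool" where
  "e_convex C \<longleftrightarrow> (\<exists>\<H>. (\<forall>H\<in>\<H>. open_halfspace H) \<and> C = \<Inter>\<H>)"

definition e_conv :: "'a::locally_convex_space set \<Rightarrow> 'a set" where
  "e_conv C = \<Inter>{D. e_convex D \<and> C \<subseteq> D}"

text \<open>Intersections of e-convex sets are e-convex, so \<open>e_conv C\<close> is the smallest
  e-convex set containing \<open>C\<close>.\<close>

lemma e_convex_Inter:
  assumes "\<And>C. C \<in> \<C> \<Longrightarrow> e_convex C"
  shows "e_convex (\<Inter>\<C>)"
proof -
  have "\<forall>C\<in>\<C>. \<exists>\<H>. (\<forall>H\<in>\<H>. open_halfspace H) \<and> C = \<Inter>\<H>"
    using assms by (simp add: e_convex_def)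
  then obtain F where F: "\<forall>C\<in>\<C>. (\<forall>H\<in>F C. open_halfspace H) \<and> C = \<Inter>(F C)"
    by (rule bchoice[THEN exE])
  have "\<Inter>\<C> = (\<Inter>C\<in>\<C>. \<Inter>(F C))"
    by (rule arg_cong[where f = Inter]) (use F in \<open>simp add: image_def\<close>)
  also have "\<dots> = \<Inter>(\<Union>(F ` \<C>))"
    by blast
  finally have "\<Inter>\<C> = \<Inter>(\<Union>(F ` \<C>))" .
  moreover have "\<forall>H\<in>\<Union>(F ` \<C>). open_halfspace H"
    using F by simp
  ultimately show ?thesis
    unfolding e_convex_def by (intro exI[of _ "\<Union>(F ` \<C>)"] conjI)
qed

lemma e_conv_smallest:
  "e_convex (e_conv C)" "C \<subseteq> e_conv C" "e_convex D \<Longrightarrow> C \<subseteq> D \<Longrightarrow> e_conv C \<subseteq> D"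
  unfolding e_conv_def by (rule e_convex_Inter, simp) blast+


section \<open>Set-valued functions\<close>

text \<open>Sums of sets are Minkowski sums, as provided by \<^theory>\<open>HOL-Library.Set_Algebras\<close>;
  in particular \<open>A + {} = {}\<close>.\<close>

definition R_cone :: "'z::locally_convex_space set \<Rightarrow> 'z set set" where
  "R_cone K = {A. A = e_conv (A + K)}"

definition le_cone :: "'z::locally_convex_space set \<Rightarrow> 'z set \<Rightarrow> 'z set \<Rightarrow> bool" where
  "le_cone K A B \<longleftrightarrow> B \<subseteq> A + K"

definition upper :: "'z::locally_convex_space set \<Rightarrow> ('x \<Rightarrow> 'z set) \<Rightarrow> 'x \<Rightarrow> 'z set" where
  "upper K f = (\<lambda>x. f x + K)"

definition sv_dom :: "('x \<Rightarrow> 'z set) \<Rightarrow> 'x set" where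
  "sv_dom f = {x. f x \<noteq> {}}"

definition sv_proper :: "('x \<Rightarrow> 'z set) \<Rightarrow> bool" where
  "sv_proper f \<longleftrightarrow> sv_dom f \<noteq> {} \<and> (\<forall>x\<in>sv_dom f. f x \<noteq> UNIV)"

definition epi :: "'z::locally_convex_space set \<Rightarrow> ('x \<Rightarrow> 'z set) \<Rightarrow> ('x \<times> 'z) set" where
  "epi K f = {(x, z). z \<in> f x + K}"

definition K_e_convex ::
    "'z::locally_convex_space set \<Rightarrow> ('x::locally_convex_space \<Rightarrow> 'z set) \<Rightarrow> bool" where
  "K_e_convex K f \<longleftrightarrow> e_convex (epi K f)"

definition S_fun :: "('x \<Rightarrow> real) \<Rightarrow> ('z \<Rightarrow> real) \<Rightarrow> 'x \<Rightarrow> 'z set" where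
  "S_fun x' z' x = {z. x' x + z' z < 0}"

definition e_affine ::
    "'z::locally_convex_space set \<Rightarrow> ('x::locally_convex_space \<Rightarrow> 'z set) \<Rightarrow> bool" where
  "e_affine K a \<longleftrightarrow>
     (\<forall>x. a x \<in> R_cone K) \<and>
     (\<exists>x'\<in>top_dual. \<exists>y'\<in>top_dual. \<exists>z'\<in>polar_cone K - {\<lambda>_. 0}. \<exists>zt. \<exists>\<alpha>::real.
        \<forall>x. a x = (if y' x < \<alpha> then S_fun x' z' x + {zt} else {}))"

definition e_affine_minorants ::
    "'z::locally_convex_space set \<Rightarrow> ('x::locally_convex_space \<Rightarrow> 'z set) \<Rightarrow> ('x \<Rightarrow> 'z set) set" where
  "e_affine_minorants K f = {a. e_affine K a \<and> (\<forall>x. le_cone K (a x) (f x))}"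

end

theory Submission
  imports Defs
begin

text \<open>A point outside \<open>epi K f\<close> is separated from it by a continuous functional
  \<open>(x, z) \<mapsto> x' x + z' z\<close>, and \<open>z' \<in> K\<^sup>*\<close> because \<open>epi K f\<close> is stable under adding \<open>{0} \<times> K\<close>.
  If \<open>z' \<noteq> 0\<close>, the half-space is the epigraph of an e-affine minorant. If \<open>z' = 0\<close>, the
  functional separates the point from the domain of \<open>f\<close>; restricting the domain of any
  e-affine minorant by this functional excludes the point, and properness provides such a
  minorant: a separating half-space at a point above the domain is never vertical.
  Conversely, the epigraph of an e-affine function is an intersection of two open half-spaces,
  and no value of an e-affine function is the whole space.\<close>

section \<open>Continuous functionals and product spaces\<close>

lemma top_dual_zero: "(\<lambda>_. 0) \<in> top_dual"
  by (simp add: top_dual_def linear_zero)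

lemma polar_cone_zero: "(\<lambda>_. 0) \<in> polar_cone K"
  by (simp add: polar_cone_def top_dual_zero)

lemma top_dual_linear: "\<phi> \<in> top_dual \<Longrightarrow> linear \<phi>"
  by (simp add: top_dual_def)

lemma linear_functional_surj:
  fixes \<phi> :: "'a::real_vector \<Rightarrow> real"
  assumes "linear \<phi>" "\<phi> \<noteq> (\<lambda>_. 0)"
  obtains y where "\<phi> y = c"
proof -
  obtain u where "\<phi> u \<noteq> 0"
    using assms(2) by auto
  then have "\<phi> ((c / \<phi> u) *\<^sub>R u) = c"
    using assms(1) by (simp add: linear_scale)
  then show ?thesis
    by (rule that)
qed

text \<open>Evaluation on the two axes identifies the dual of the product with the product of the
  duals. A functional separating a point from an epigraph thus becomes a pair of functionals on the
  two factors.\<close>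

lemma top_dual_prod_split:
  fixes \<phi> :: "'a::locally_convex_space \<times> 'b::locally_convex_space \<Rightarrow> real"
  assumes "\<phi> \<in> top_dual"
  shows "(\<lambda>x. \<phi> (x, 0)) \<in> top_dual" "(\<lambda>z. \<phi> (0, z)) \<in> top_dual"
    "\<phi> (x, z) = \<phi> (x, 0) + \<phi> (0, z)"
proof -
  have l: "linear \<phi>" and c: "continuous_on UNIV \<phi>"
    using assms by (simp_all add: top_dual_def)
  have sc: "\<phi> (r *\<^sub>R x, 0) = r * \<phi> (x, 0)" "\<phi> (0, r *\<^sub>R z) = r * \<phi> (0, z)" for r x z
    using linear_scale[OF l, of r "(x, 0)"] linear_scale[OF l, of r "(0, z)"] by simp_all
  have "continuous_on UNIV (\<lambda>x. \<phi> (x, 0))" "continuous_on UNIV (\<lambda>z. \<phi> (0, z))"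
    by (rule continuous_on_compose2[OF c]; (intro continuous_intros)?; simp)+
  moreover have "linear (\<lambda>x. \<phi> (x, 0))"
    by (rule linearI) (simp_all add: sc flip: linear_add[OF l])
  moreover have "linear (\<lambda>z. \<phi> (0, z))"
    by (rule linearI) (simp_all add: sc flip: linear_add[OF l])
  ultimately show "(\<lambda>x. \<phi> (x, 0)) \<in> top_dual" "(\<lambda>z. \<phi> (0, z)) \<in> top_dual"
    by (simp_all add: top_dual_def)
  show "\<phi> (x, z) = \<phi> (x, 0) + \<phi> (0, z)"
    by (simp flip: linear_add[OF l])
qed

lemma top_dual_prod_sum:
  assumes "\<phi> \<in> top_dual" "\<psi> \<in> top_dual"
  shows "(\<lambda>p. \<phi> (fst p) + \<psi> (snd p)) \<in> top_dual"
proof -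
  have c: "continuous_on UNIV \<phi>" "continuous_on UNIV \<psi>" and l: "linear \<phi>" "linear \<psi>"
    using assms by (simp_all add: top_dual_def)
  have "continuous_on UNIV (\<lambda>p. \<phi> (fst p) + \<psi> (snd p))"
    by (intro continuous_on_add continuous_on_compose2[OF c(1)] continuous_on_compose2[OF c(2)]
        continuous_on_fst continuous_on_snd continuous_on_id) auto
  moreover have "linear (\<lambda>p. \<phi> (fst p) + \<psi> (snd p))"
    by (rule linearI)
      (simp_all add: linear_add[OF l(1)] linear_add[OF l(2)] linear_scale[OF l(1)]
        linear_scale[OF l(2)] algebra_simps)
  ultimately show ?thesis
    by (simp add: top_dual_def)
qed

section \<open>Evenly convex sets\<close>

lemma e_convex_UNIV: "e_convex UNIV"
  unfolding e_convex_def by (rule exI[of _ "{}"]) simp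

lemma e_convex_open_halfspace: "open_halfspace H \<Longrightarrow> e_convex H"
  unfolding e_convex_def by (rule exI[of _ "{H}"]) simp

lemma e_convex_Int: "e_convex A \<Longrightarrow> e_convex B \<Longrightarrow> e_convex (A \<inter> B)"
  using e_convex_Inter[of "{A, B}"] by auto

text \<open>The half-spaces \<open>{y. \<phi> y < \<alpha>}\<close> of all levels have no common
  point, since \<open>y\<close> fails at level \<open>\<phi> y\<close>.\<close>

lemma e_convex_empty:
  fixes \<phi> :: "'a::locally_convex_space \<Rightarrow> real"
  assumes "\<phi> \<in> top_dual" "\<phi> \<noteq> (\<lambda>_. 0)"
  shows "e_convex ({} :: 'a::locally_convex_space set)"
proof -
  have "e_convex (\<Inter>\<alpha>. {y. \<phi> y < \<alpha>})"
    using assms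
    by (intro e_convex_Inter)
      (fastforce intro: e_convex_open_halfspace simp: open_halfspace_def)
  moreover have "(\<Inter>\<alpha>. {y. \<phi> y < \<alpha>}) = {}"
    by auto
  ultimately show ?thesis
    by simp
qed

text \<open>In a trivial space the empty set is not e-convex, hence the assumption on \<open>\<psi>\<close>.\<close>

lemma e_convex_sublevel:
  fixes \<phi> \<psi> :: "'a::locally_convex_space \<Rightarrow> real"
  assumes "\<phi> \<in> top_dual" "\<psi> \<in> top_dual" "\<psi> \<noteq> (\<lambda>_. 0)"
  shows "e_convex {y. \<phi> y < \<alpha>}"
proof (cases "\<phi> = (\<lambda>_. 0)")
  \<comment> \<open>The zero functional defines no open half-space: its sublevel set is everything
    if \<open>\<alpha>\<close> is positive and empty otherwise.\<close>
  case True
  then show ?thesis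
    using e_convex_UNIV e_convex_empty[OF assms(2,3)] by (cases "0 < \<alpha>") auto
next
  case False
  then show ?thesis
    using assms(1) by (intro e_convex_open_halfspace) (auto simp: open_halfspace_def)
qed

lemma e_conv_e_convex: "e_convex C \<Longrightarrow> e_conv C = C"
  using e_conv_smallest(2)[of C] e_conv_smallest(3)[of C C] by auto

text \<open>The point misses some half-space \<open>{y. \<phi> y < \<alpha>}\<close> of the family,
  hence \<open>\<alpha> \<le> \<phi> p\<close>, while all of \<open>C\<close> lies strictly below
  \<open>\<alpha>\<close>.\<close>

lemma e_convex_separation:
  assumes "e_convex C" "p \<notin> C"
  obtains \<phi> where "\<phi> \<in> top_dual" "\<And>y. y \<in> C \<Longrightarrow> \<phi> y < \<phi> p"
proof -
  obtain \<H> where \<H>: "\<forall>H\<in>\<H>. open_halfspace H" "C = \<Inter>\<H>"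
    using assms(1) by (auto simp: e_convex_def)
  then obtain H where "H \<in> \<H>" "p \<notin> H"
    using assms(2) by auto
  moreover from this obtain \<phi> \<alpha> where "\<phi> \<in> top_dual" "H = {y. \<phi> y < \<alpha>}"
    using \<H>(1) unfolding open_halfspace_def by blast
  ultimately show ?thesis
    using \<H>(2) by (intro that[of \<phi>]) (auto intro: less_le_trans)
qed

section \<open>Sums with a convex cone\<close>

lemma subset_plus_convex_cone:
  assumes "convex_cone K"
  shows "A \<subseteq> A + K"
  using set_zero_plus2[OF convex_cone_contains_0[OF assms]] by (simp add: add.commute)

lemma convex_cone_plus_self:
  assumes "convex_cone K"
  shows "K + K = K"
proof
  show "K + K \<subseteq> K"
    using assms by (auto elim!: set_plus_elim intro: convex_cone_add)
  show "K \<subseteq> K + K"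
    by (rule subset_plus_convex_cone[OF assms])
qed

section \<open>e-affine functions as sublevel sets\<close>

lemma S_fun_translate:
  assumes "linear z'"
  shows "S_fun x' z' x + {zt} = {z. x' x + z' z < z' zt}"
proof -
  have "z \<in> S_fun x' z' x + {zt} \<longleftrightarrow> z - zt \<in> S_fun x' z' x" for z
    by (auto simp: set_plus_def intro!: bexI[of _ "z - zt"])
  moreover have "z - zt \<in> S_fun x' z' x \<longleftrightarrow> x' x + z' z < z' zt" for z
    by (simp add: S_fun_def linear_diff[OF assms] less_diff_eq add_diff_eq)
  ultimately show ?thesis
    by blast
qed

text \<open>Adding an element of \<open>K\<close> can only lower \<open>z'\<close>; the other
  inclusion comes from \<open>0 \<in> K\<close>.\<close>

lemma sublevel_plus_cone:
  assumes "convex_cone K" "z' \<in> polar_cone K"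
  shows "{z. c + z' z < d} + K = {z. c + z' z < (d::real)}"
proof
  have l: "linear z'" and n: "\<And>k. k \<in> K \<Longrightarrow> z' k \<le> 0"
    using assms(2) by (auto simp: polar_cone_def top_dual_def)
  show "{z. c + z' z < d} + K \<subseteq> {z. c + z' z < d}"
    using n by (force elim!: set_plus_elim simp: linear_add[OF l])
  show "{z. c + z' z < d} \<subseteq> {z. c + z' z < d} + K"
    by (rule subset_plus_convex_cone[OF assms(1)])
qed

text \<open>The translation vector \<open>zt\<close> enters an e-affine function only through \<open>z' zt\<close>, which
  ranges over all reals.\<close>

lemma e_affineE:
  assumes "e_affine K a"
  obtains x' y' z' \<beta> \<alpha> where "x' \<in> top_dual" "y' \<in> top_dual" "z' \<in> polar_cone K"
    "z' \<noteq> (\<lambda>_. 0)" "a = (\<lambda>x. {z. y' x < \<alpha> \<and> x' x + z' z < \<beta>})"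
proof -
  obtain x' y' z' zt \<alpha> where *: "x' \<in> top_dual" "y' \<in> top_dual"
    "z' \<in> polar_cone K - {\<lambda>_. 0}"
    "\<forall>x. a x = (if y' x < \<alpha> then S_fun x' z' x + {zt} else {})"
    using assms unfolding e_affine_def by (elim conjE bexE exE)
  then have "linear z'"
    by (simp add: polar_cone_def top_dual_def)
  then have "a = (\<lambda>x. {z. y' x < \<alpha> \<and> x' x + z' z < z' zt})"
    using *(4) S_fun_translate[of z' x' _ zt] by (auto simp: fun_eq_iff)
  with * show ?thesis
    by (intro that[of x' y' z']) auto
qed

text \<open>The values lie in \<open>R_cone K\<close> because each is e-convex and already absorbs
  \<open>K\<close>. For the empty value, e-convexity rests on \<open>z'\<close> being
  nonzero.\<close>

lemma e_affineI:
  fixes K :: "'z::locally_convex_space set"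
    and x' y' :: "'x::locally_convex_space \<Rightarrow> real"
  assumes K: "convex_cone K"
    and "x' \<in> top_dual" "y' \<in> top_dual" "z' \<in> polar_cone K" "z' \<noteq> (\<lambda>_. 0)"
  shows "e_affine K (\<lambda>x. {z. y' x < \<alpha> \<and> x' x + z' z < \<beta>})" (is "e_affine K ?a")
proof -
  have z': "z' \<in> top_dual" "z' \<noteq> (\<lambda>_. 0)" and l: "linear z'"
    using assms(4,5) by (auto simp: polar_cone_def top_dual_def)
  obtain zt where zt: "z' zt = \<beta>"
    using linear_functional_surj[OF l z'(2)] .
  have "\<forall>x. ?a x = (if y' x < \<alpha> then S_fun x' z' x + {zt} else {})"
    using zt by (simp add: S_fun_translate[OF l])
  moreover have "?a x \<in> R_cone K" for x
  proof (cases "y' x < \<alpha>")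
    case True
    then have "?a x = {z. z' z < \<beta> - x' x}" "?a x + K = ?a x"
      using sublevel_plus_cone[OF K assms(4), of "x' x" \<beta>] by (auto simp: algebra_simps)
    then show ?thesis
      using e_conv_e_convex[OF e_convex_sublevel[OF z'(1) z']] by (simp add: R_cone_def)
  next
    case False
    moreover have "{} + K = {}"
      by (auto elim: set_plus_elim)
    ultimately show ?thesis
      using e_conv_e_convex[OF e_convex_empty[OF z']] by (simp add: R_cone_def)
  qed
  moreover have "z' \<in> polar_cone K - {\<lambda>_. 0}"
    using assms(4,5) by simp
  ultimately show ?thesis
    unfolding e_affine_def using assms(2,3)
    by (intro conjI allI bexI[of _ x'] bexI[of _ y'] bexI[of _ z'] exI[of _ zt] exI[of _ \<alpha>])
      (simp_all only:)
qed

lemma e_affine_plus_cone: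
  assumes K: "convex_cone K" and a: "e_affine K a"
  shows "a x + K = a x"
proof -
  obtain x' y' z' \<beta> and \<alpha> :: real where "z' \<in> polar_cone K"
    and "a = (\<lambda>x. {z. y' x < \<alpha> \<and> x' x + z' z < \<beta>})"
    using a by (rule e_affineE)
  moreover have "{} + K = {}"
    by (auto elim: set_plus_elim)
  ultimately show ?thesis
    using sublevel_plus_cone[OF K, of z' "x' x" \<beta>] by (cases "y' x < \<alpha>") simp_all
qed

text \<open>The nonzero functional \<open>z'\<close> takes the value \<open>\<beta> - x' x\<close>,
  where the strict inequality fails.\<close>

lemma e_affine_neq_UNIV:
  assumes a: "e_affine K a"
  shows "a x \<noteq> UNIV"
proof -
  obtain x' y' z' \<beta> and \<alpha> :: real where z': "z' \<in> polar_cone K" "z' \<noteq> (\<lambda>_. 0)"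
    and a_eq: "a = (\<lambda>x. {z. y' x < \<alpha> \<and> x' x + z' z < \<beta>})"
    using a by (rule e_affineE)
  have "linear z'"
    using z'(1) by (simp add: polar_cone_def top_dual_def)
  then obtain z where "z' z = \<beta> - x' x"
    using z'(2) by (rule linear_functional_surj)
  then have "z \<notin> a x"
    by (simp add: a_eq)
  then show ?thesis
    by blast
qed

lemma e_affine_K_e_convex:
  fixes K :: "'z::locally_convex_space set"
    and a :: "'x::locally_convex_space \<Rightarrow> 'z set"
  assumes K: "convex_cone K" and a: "e_affine K a"
  shows "K_e_convex K a"
proof -
  obtain x' y' z' \<beta> \<alpha> where *: "x' \<in> top_dual" "y' \<in> top_dual" "z' \<in> polar_cone K"
    "z' \<noteq> (\<lambda>_. 0)" and a_eq: "a = (\<lambda>x. {z. y' x < \<alpha> \<and> x' x + z' z < \<beta>})"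
    using a by (rule e_affineE)
  then have z': "z' \<in> top_dual" "z' \<noteq> (\<lambda>_. 0)"
    by (simp_all add: polar_cone_def)
  \<comment> \<open>A nonzero functional on the product, as \<open>e_convex_sublevel\<close>
    requires: \<open>y'\<close> may vanish, and its sublevel set may then be empty.\<close>
  let ?\<psi> = "\<lambda>p::'x \<times> 'z. 0 + z' (snd p)"
  have \<psi>: "?\<psi> \<in> top_dual"
    by (rule top_dual_prod_sum[OF top_dual_zero z'(1)])
  have \<psi>0: "?\<psi> \<noteq> (\<lambda>_. 0)"
    using z'(2) by (auto simp: fun_eq_iff)
  have "epi K a = {p. y' (fst p) + 0 < \<alpha>} \<inter> {p. x' (fst p) + z' (snd p) < \<beta>}"
    unfolding epi_def e_affine_plus_cone[OF K a] by (auto simp: a_eq)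
  then show ?thesis
    unfolding K_e_convex_def
    using e_convex_sublevel[OF top_dual_prod_sum[OF *(2) top_dual_zero] \<psi> \<psi>0]
      e_convex_sublevel[OF top_dual_prod_sum[OF *(1) z'(1)] \<psi> \<psi>0]
    by (simp add: e_convex_Int)
qed

text \<open>The order \<open>le_cone\<close> reduces to plain inclusion because the values of
  \<open>a\<close> absorb \<open>K\<close> and \<open>0 \<in> K\<close> puts \<open>f x\<close>
  inside \<open>f x + K\<close>.\<close>

lemma e_affine_minorants_iff:
  assumes K: "convex_cone K"
  shows "a \<in> e_affine_minorants K f \<longleftrightarrow> e_affine K a \<and> (\<forall>x. f x + K \<subseteq> a x)"
proof -
  have "f x \<subseteq> a x + K \<longleftrightarrow> f x + K \<subseteq> a x" if "e_affine K a" for x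
  proof
    assume "f x \<subseteq> a x + K"
    then have "f x + K \<subseteq> a x + K + K"
      by (rule set_plus_mono2) simp
    then show "f x + K \<subseteq> a x"
      by (simp add: e_affine_plus_cone[OF K that])
  next
    assume "f x + K \<subseteq> a x"
    moreover have "f x \<subseteq> f x + K"
      by (rule subset_plus_convex_cone[OF K])
    ultimately show "f x \<subseteq> a x + K"
      by (simp add: e_affine_plus_cone[OF K that])
  qed
  then show ?thesis
    by (auto simp: e_affine_minorants_def le_cone_def)
qed

section \<open>Separation from the epigraph\<close>

lemma functional_bounded_on_ray:
  fixes s t :: real
  assumes "\<And>c. c \<ge> 0 \<Longrightarrow> s + c * t < d"
  shows "t \<le> 0"
proof (rule ccontr)
  assume "\<not> t \<le> 0"
  \<comment> \<open>If \<open>t\<close> is positive, this multiple raises the left side to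
    \<open>s + \<bar>d - s\<bar>\<close>, which is at least \<open>d\<close>.\<close>
  moreover from this have "s + (\<bar>d - s\<bar> / t) * t < d"
    by (intro assms) simp
  ultimately show False
    by simp
qed

lemma K_e_convex_separation:
  fixes K :: "'z::locally_convex_space set"
    and f :: "'x::locally_convex_space \<Rightarrow> 'z set"
  assumes K: "convex_cone K" and f: "K_e_convex K f"
    and dom: "f x1 + K \<noteq> {}" and z0: "z0 \<notin> f x0 + K"
  obtains x' z' where "x' \<in> top_dual" "z' \<in> polar_cone K"
    "\<And>x z. z \<in> f x + K \<Longrightarrow> x' x + z' z < x' x0 + z' z0"
proof -
  have "(x0, z0) \<notin> epi K f"
    using z0 by (simp add: epi_def)
  with f obtain \<phi> where \<phi>: "\<phi> \<in> top_dual" "\<And>p. p \<in> epi K f \<Longrightarrow> \<phi> p < \<phi> (x0, z0)"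
    unfolding K_e_convex_def by (rule e_convex_separation) blast
  let ?x = "\<lambda>x. \<phi> (x, 0)" and ?z = "\<lambda>z. \<phi> (0, z)"
  note split = top_dual_prod_split[OF \<phi>(1)]
  have sep: "?x x + ?z z < ?x x0 + ?z z0" if "z \<in> f x + K" for x z
    using \<phi>(2)[of "(x, z)"] that split(3)[of x z] split(3)[of x0 z0] by (simp add: epi_def)
  have l: "linear ?z"
    by (rule top_dual_linear[OF split(2)])
  \<comment> \<open>The rays in the directions of \<open>K\<close> start at this point of the
    epigraph; boundedness along them fixes the sign of the second component.\<close>
  obtain z1 where z1: "z1 \<in> f x1 + K"
    using dom by blast
  have "?z k \<le> 0" if k: "k \<in> K" for k
  proof (rule functional_bounded_on_ray)
    fix c :: real
    assume "c \<ge> 0"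
    then have "c *\<^sub>R k \<in> K"
      using K k by (simp add: convex_cone_scaleR)
    then have "z1 + c *\<^sub>R k \<in> f x1 + K + K"
      using z1 by (intro set_plus_intro)
    then have "z1 + c *\<^sub>R k \<in> f x1 + K"
      by (simp add: add.assoc convex_cone_plus_self[OF K])
    from sep[OF this] show "(?x x1 + ?z z1) + c * ?z k < ?x x0 + ?z z0"
      by (simp add: linear_add[OF l] linear_scale[OF l])
  qed
  then have "?z \<in> polar_cone K"
    using split(2) by (simp add: polar_cone_def)
  from that[OF split(1) this sep] show ?thesis .
qed

lemma proper_K_e_convex_minorant:
  fixes K :: "'z::locally_convex_space set"
    and f :: "'x::locally_convex_space \<Rightarrow> 'z set"
  assumes K: "convex_cone K" and f: "K_e_convex K f" and proper: "sv_proper (upper K f)"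
    and z0: "z0 \<notin> f x0 + K"
  obtains a where "a \<in> e_affine_minorants K f" "z0 \<notin> a x0"
proof -
  obtain x1 where dom: "f x1 + K \<noteq> {}" and "f x1 + K \<noteq> UNIV"
    using proper by (auto simp: sv_proper_def sv_dom_def upper_def)
  \<comment> \<open>Both points lie over the same \<open>x1\<close>, so that no vertical half-space
    can separate them.\<close>
  then obtain z1 z2 where z1: "z1 \<in> f x1 + K" and z2: "z2 \<notin> f x1 + K"
    by blast
  obtain x' z' where x': "x' \<in> top_dual" and z': "z' \<in> polar_cone K"
    and sep: "\<And>x z. z \<in> f x + K \<Longrightarrow> x' x + z' z < x' x0 + z' z0"
    using K_e_convex_separation[OF K f dom z0] by metis
  show ?thesis
  proof (cases "z' = (\<lambda>_. 0)")
    case False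
    \<comment> \<open>The constraint \<open>0 < 1\<close> encodes \<open>y' = 0\<close> and
      \<open>\<alpha> = 1\<close>: the domain is all of the space.\<close>
    define a where "a = (\<lambda>x. {z. (0::real) < 1 \<and> x' x + z' z < x' x0 + z' z0})"
    have "e_affine K a"
      unfolding a_def by (rule e_affineI[OF K x' top_dual_zero z' False])
    then have "a \<in> e_affine_minorants K f"
      unfolding e_affine_minorants_iff[OF K] using sep by (auto simp: a_def)
    then show ?thesis
      by (rule that) (simp add: a_def)
  next
    case True
    obtain x'' z'' where x'': "x'' \<in> top_dual" and z'': "z'' \<in> polar_cone K"
      and sep'': "\<And>x z. z \<in> f x + K \<Longrightarrow> x'' x + z'' z < x'' x1 + z'' z2"
      using K_e_convex_separation[OF K f dom z2] by metis
    \<comment> \<open>Otherwise the inequality at \<open>(x1, z1)\<close> would read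
      \<open>x'' x1 < x'' x1\<close>.\<close>
    have "z'' \<noteq> (\<lambda>_. 0)"
      using sep''[OF z1] by auto
    \<comment> \<open>Since \<open>z' = 0\<close>, \<open>sep\<close> says that
      \<open>x' x < x' x0\<close> on the whole domain of \<open>f\<close>; truncating there keeps
      the minorant and empties its value at \<open>x0\<close>.\<close>
    define a where "a = (\<lambda>x. {z. x' x < x' x0 \<and> x'' x + z'' z < x'' x1 + z'' z2})"
    have "e_affine K a"
      unfolding a_def by (rule e_affineI[OF K x'' x' z'' \<open>z'' \<noteq> (\<lambda>_. 0)\<close>])
    then have "a \<in> e_affine_minorants K f"
      unfolding e_affine_minorants_iff[OF K] using sep sep'' True by (auto simp: a_def)
    then show ?thesis
      by (rule that) (simp add: a_def)
  qed
qed

text \<open>The assumption \<open>nondegenerate\<close> excludes the everywhere empty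
  \<open>f\<close> with zero polar cone. In that case no e-affine function exists, and the supremum
  over the empty family is \<open>UNIV\<close> instead of the empty set.\<close>

theorem theorem4:
  fixes K :: "'z::locally_convex_space set"
    and f :: "'x::locally_convex_space \<Rightarrow> 'z set"
  assumes X_nontrivial: "(UNIV :: 'x set) \<noteq> {0}"
    and Z_nontrivial: "(UNIV :: 'z set) \<noteq> {0}"
    and K_cone: "convex_cone K"
    and K_nontrivial: "{0} \<subset> K" "K \<subset> UNIV"
    and nondegenerate: "polar_cone K \<noteq> {\<lambda>_. 0} \<or> (\<exists>x. f x \<noteq> {})"
  shows "(\<forall>x. f x + K = (\<Inter>a\<in>e_affine_minorants K f. a x + K)) \<longleftrightarrow>
         K_e_convex K f \<and>
         (sv_proper (upper K f) \<or> (\<forall>x. upper K f x = {}) \<or> (\<forall>x. upper K f x = UNIV))"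
    (is "?sup \<longleftrightarrow> _ \<and> ?cases")
proof
  assume sup: ?sup
  have "z \<in> f x + K \<longleftrightarrow> (\<forall>a\<in>e_affine_minorants K f. z \<in> a x + K)" for x z
    by (subst sup[rule_format]) (rule INT_iff)
  \<comment> \<open>On epigraphs the pointwise supremum is an intersection, which preserves
    e-convexity.\<close>
  then have "epi K f = (\<Inter>a\<in>e_affine_minorants K f. epi K a)"
    unfolding epi_def by fastforce
  moreover have "e_convex (\<Inter>a\<in>e_affine_minorants K f. epi K a)"
    using e_affine_K_e_convex[OF K_cone]
    by (intro e_convex_Inter) (auto simp: e_affine_minorants_def K_e_convex_def)
  ultimately have "K_e_convex K f"
    by (simp add: K_e_convex_def)
  moreover have ?cases
  proof (cases "\<exists>x. f x + K = UNIV")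
    case True
    then obtain x where "f x + K = UNIV" ..
    then have "\<not> f x + K \<subseteq> a x" if "e_affine K a" for a
      using e_affine_neq_UNIV[OF that, of x] by (simp add: top.extremum_unique)
    \<comment> \<open>A single value \<open>UNIV\<close> rules out every minorant, and the empty
      intersection then forces the value \<open>UNIV\<close> everywhere.\<close>
    then have "e_affine_minorants K f = {}"
      using e_affine_minorants_iff[OF K_cone, of _ f] by blast
    then show ?thesis
      using sup by (simp add: upper_def)
  next
    case False
    \<comment> \<open>With no value \<open>UNIV\<close>, \<open>upper K f\<close> is proper unless
      its domain is empty.\<close>
    then show ?thesis
      by (auto simp: sv_proper_def sv_dom_def upper_def)
  qed
  ultimately show "K_e_convex K f \<and> ?cases" ..
next
  assume R: "K_e_convex K f \<and> ?cases"
  have plus: "a x + K = a x" if "a \<in> e_affine_minorants K f" for a x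
    using that e_affine_plus_cone[OF K_cone] by (auto simp: e_affine_minorants_def)
  have le: "f x + K \<subseteq> (\<Inter>a\<in>e_affine_minorants K f. a x + K)" for x
    by (intro INT_greatest) (simp add: plus, simp add: e_affine_minorants_iff[OF K_cone])
  have "\<exists>a\<in>e_affine_minorants K f. z \<notin> a x" if z: "z \<notin> f x + K" for x z
  proof -
    have "upper K f x \<noteq> UNIV"
      using z by (metis UNIV_I upper_def)
    then consider "sv_proper (upper K f)" | "\<forall>x. f x + K = {}"
      using R unfolding upper_def by metis
    then show ?thesis
    proof cases
      case 1
      from R have "K_e_convex K f" ..
      from K_cone this 1 z obtain a where "a \<in> e_affine_minorants K f" "z \<notin> a x"
        by (rule proper_K_e_convex_minorant)
      then show ?thesis
        by blast
    next
      case 2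
      then have "\<forall>x. f x = {}"
        using subset_plus_convex_cone[OF K_cone] by (metis subset_empty)
      then have "polar_cone K \<noteq> {\<lambda>_. 0}"
        using nondegenerate by simp
      then have "\<not> polar_cone K \<subseteq> {\<lambda>_. 0}"
        using polar_cone_zero[of K] by (metis empty_iff subset_singletonD)
      then obtain z' where z': "z' \<in> polar_cone K" "z' \<noteq> (\<lambda>_. 0)"
        by (metis singletonI subsetI)
      \<comment> \<open>The constraint \<open>0 < 0\<close> makes this e-affine function empty
        everywhere, so it misses \<open>z\<close> and still minorizes the empty
        \<open>f\<close>.\<close>
      let ?a = "\<lambda>x::'x. {z. (0::real) < 0 \<and> 0 + z' z < 0}"
      have "e_affine K ?a"
        by (rule e_affineI[OF K_cone top_dual_zero top_dual_zero z'])
      then have "?a \<in> e_affine_minorants K f"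
        using 2 by (simp add: e_affine_minorants_iff[OF K_cone])
      then show ?thesis
        by (rule bexI[rotated]) simp
    qed
  qed
  then have "(\<Inter>a\<in>e_affine_minorants K f. a x + K) \<subseteq> f x + K" for x
    using plus by blast
  with le show ?sup
    by (intro allI equalityI)
qed

end
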